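(* Let $q$ be a prime power, let $C\subseteq\mathbb{F}_q^n$ be an $[n,k]$ code over $\mathbb{F}_q$, let $1\le d\le n$, let $f\in\mathrm{Harm}_d(n)$, and let $r$ be an integer with $0\le r\le k$. Then, as rational functions in $x,y$, $$Z_{C,f}^{(r)}(x,y)=\frac{1}{[r]_{q}}\sum_{j=0}^{r}\binom{r}{j}_{q}(-1)^{r+d-j}q^{\binom{r-j}{2}}(x-y)^{k-d}\,y^{n-k-d}\;T\left(M_{C},f;\;\frac{x+(q^{j}-1)y}{x-y},\;\frac{x}{y}\right).$$
   Context: Let $E=\{1,\dots,n\}$ and let $E_d$ be the set of $d$-element subsets of $E$. $\mathrm{Harm}_d(n)$ is the space of functions $f:E_d\to\mathbb{R}$ such that $\sum_{Z\in E_d,\,Y\subseteq Z}f(Z)=0$ for every $Y\in E_{d-1}$. For $X\subseteq E$ put $\widetilde f(X)=\sum_{Z\in E_d,\,Z\subseteq X}f(Z)$. An $[n,k]$ code over $\mathbb{F}_q$ is a $k$-dimensional linear subspace of $\mathbb{F}_q^n$. For a vector $\mathbf u$, $\mathrm{supp}(\mathbf u)=\{i\in E: u_i\ne 0\}$; for a set $D$ of vectors, $\mathrm{Supp}(D)=\bigcup_{\mathbf u\in D}\mathrm{supp}(\mathbf u)$ and $\mathrm{wt}(D)=|\mathrm{Supp}(D)|$. $\mathcal{D}_r(C)$ is the set of $r$-dimensional linear subspaces of $C$, and $A_{i,f}^{(r)}(C)=\sum_{D\in\mathcal{D}_r(C),\,\mathrm{wt}(D)=i}\widetilde f(\mathrm{Supp}(D))$.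 The harmonic $r$-th higher weight enumerator $W_{C,f}^{(r)}(x,y)=\sum_{i=0}^n A_{i,f}^{(r)}(C)x^{n-i}y^i$ equals $(xy)^dZ_{C,f}^{(r)}(x,y)$, where $Z_{C,f}^{(r)}(x,y)=\sum_{i=d}^{n-d}A_{i,f}^{(r)}(C)x^{n-i-d}y^{i-d}$ (an empty sum is $0$). $M_C$ is the vector matroid on $E$ of a generator matrix $G$ of $C$ (a $k\times n$ matrix whose rows form a basis of $C$): a set $I\subseteq E$ is independent iff the columns of $G$ indexed by $I$ are linearly independent; it does not depend on the choice of $G$. For a matroid $M$ on $E$ with rank function $\rho$, the harmonic Tutte polynomial of $M$ associated to $f$ is $$T(M,f;x,y)=\sum_{X\subseteq E}\widetilde f(X)\,(x-1)^{\rho(E)-\rho(X)}(y-1)^{|X|-\rho(X)}.$$ For integers $a,b\ge0$, $[a,b]_q=\prod_{i=0}^{b-1}(q^a-q^i)$, $[a]_q=[a,a]_q$, and $\binom{a}{b}_q=[a,b]_q/[b]_q$ is the Gaussian binomial coefficient; $\binom{r-j}{2}$ is an ordinary binomial coefficient. *)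

theory Defs
  imports
    "HOL-Analysis.Analysis"
    "HOL-Computational_Algebra.Fraction_Field"
begin

text \<open>
  Conventions.  The ground set \<open>E = {1,\<dots>,n}\<close> is the universe of a finite index type \<open>'n\<close> with
  \<open>n = CARD('n)\<close>; the alphabet is a finite field \<open>'a\<close> with \<open>q = CARD('a)\<close>; words are elements
  of \<open>'a ^ 'n\<close>, so an \<open>[n,k]\<close> code is a set \<open>C\<close> with \<open>vec.subspace C\<close> and \<open>vec.dim C = k\<close>.
\<close>


section \<open>Harmonic functions\<close>

text \<open>
  A function on the \<open>d\<close>-subsets of \<open>E\<close> is represented by a total function on all subsets whose
  values at sets of other cardinalities are never used.
\<close>

definition harmonic :: "nat \<Rightarrow> ('n::finite set \<Rightarrow> real) \<Rightarrow> bool" where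
  "harmonic d f \<longleftrightarrow> (\<forall>Y. card Y = d - 1 \<longrightarrow> (\<Sum>Z | card Z = d \<and> Y \<subseteq> Z. f Z) = 0)"

definition harm_tilde :: "nat \<Rightarrow> ('n::finite set \<Rightarrow> real) \<Rightarrow> 'n set \<Rightarrow> real" where
  "harm_tilde d f X = (\<Sum>Z | card Z = d \<and> Z \<subseteq> X. f Z)"


section \<open>Rational functions in two variables\<close>

type_synonym ratfun = "real poly poly fract"

definition rf_const :: "real \<Rightarrow> ratfun" where
  "rf_const c = Fraction_Field.Fract [:[:c:]:] 1"

definition rf_x :: ratfun where
  "rf_x = Fraction_Field.Fract [:[:0, 1:]:] 1"

definition rf_y :: ratfun where
  "rf_y = Fraction_Field.Fract [:0, 1:] 1"


section \<open>Harmonic higher weight enumerators\<close>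

definition vsupp :: "'a::zero ^ 'n \<Rightarrow> 'n set" where
  "vsupp u = {i. u $ i \<noteq> 0}"

definition Supp :: "('a::zero ^ 'n) set \<Rightarrow> 'n set" where
  "Supp D = (\<Union>u\<in>D. vsupp u)"

definition wt :: "('a::zero ^ 'n) set \<Rightarrow> nat" where
  "wt D = card (Supp D)"

definition subcodes :: "nat \<Rightarrow> ('a::field ^ 'n::finite) set \<Rightarrow> ('a ^ 'n) set set" where
  "subcodes r C = {D. vec.subspace D \<and> D \<subseteq> C \<and> vec.dim D = r}"

definition harm_weight ::
    "('a::{field,finite} ^ 'n::finite) set \<Rightarrow> nat \<Rightarrow> ('n set \<Rightarrow> real) \<Rightarrow> nat \<Rightarrow> nat \<Rightarrow> real" where
  "harm_weight C d f r i = (\<Sum>D | D \<in> subcodes r C \<and> wt D = i. harm_tilde d f (Supp D))"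

text \<open>The polynomial \<open>Z\<close>; the sum is empty when \<open>n < 2 * d\<close> (recall \<open>d \<le> n\<close>).\<close>

definition harm_Z ::
    "('a::{field,finite} ^ 'n::finite) set \<Rightarrow> nat \<Rightarrow> ('n set \<Rightarrow> real) \<Rightarrow> nat \<Rightarrow>
     ratfun \<Rightarrow> ratfun \<Rightarrow> ratfun" where
  "harm_Z C d f r x y =
     (\<Sum>i = d..CARD('n) - d.
        rf_const (harm_weight C d f r i) * x ^ (CARD('n) - i - d) * y ^ (i - d))"


section \<open>Matroids and the harmonic Tutte polynomial\<close>

text \<open>A matroid is given by its family \<open>M\<close> of independent sets; its ground set is the universe.\<close>

definition matroid :: "'n::finite set set \<Rightarrow> bool" where
  "matroid M \<longleftrightarrow>
     {} \<in> M \<and>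
     (\<forall>I J. J \<in> M \<and> I \<subseteq> J \<longrightarrow> I \<in> M) \<and>
     (\<forall>I J. I \<in> M \<and> J \<in> M \<and> card I < card J \<longrightarrow> (\<exists>e\<in>J - I. insert e I \<in> M))"

definition matroid_rank :: "'n::finite set set \<Rightarrow> 'n set \<Rightarrow> nat" where
  "matroid_rank M X = Max (card ` {I. I \<in> M \<and> I \<subseteq> X})"

text \<open>
  The natural-number subtractions do not truncate, since \<open>\<rho>(X) \<le> \<rho>(E)\<close> and \<open>\<rho>(X) \<le> card X\<close>.
\<close>

definition harm_tutte ::
    "'n::finite set set \<Rightarrow> nat \<Rightarrow> ('n set \<Rightarrow> real) \<Rightarrow> ratfun \<Rightarrow> ratfun \<Rightarrow> ratfun" where
  "harm_tutte M d f x y =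
     (\<Sum>X\<in>UNIV. rf_const (harm_tilde d f X)
        * (x - 1) ^ (matroid_rank M UNIV - matroid_rank M X)
        * (y - 1) ^ (card X - matroid_rank M X))"


section \<open>The matroid of a code\<close>

text \<open>
  A generator matrix is given by the list of its rows; its column \<open>j\<close> has the entries
  \<open>G ! i $ j\<close> for \<open>i < length G\<close>.
\<close>

definition generator_matrix :: "('a::field ^ 'n::finite) set \<Rightarrow> ('a ^ 'n) list \<Rightarrow> bool" where
  "generator_matrix C G \<longleftrightarrow> distinct G \<and> vec.independent (set G) \<and> vec.span (set G) = C"

text \<open>
  Linear independence of columns is that of an indexed family, so equal columns at different
  indices are dependent.
\<close>

definition columns_independent :: "('a::field ^ 'n::finite) list \<Rightarrow> 'n set \<Rightarrow> bool" where
  "columns_independent G I \<longleftrightarrow>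
     (\<forall>c. (\<forall>i<length G. (\<Sum>j\<in>I. c j * G ! i $ j) = 0) \<longrightarrow> (\<forall>j\<in>I. c j = 0))"

definition vector_matroid :: "('a::field ^ 'n::finite) list \<Rightarrow> 'n set set" where
  "vector_matroid G = {I. columns_independent G I}"

definition code_matroid :: "('a::field ^ 'n::finite) set \<Rightarrow> 'n set set" where
  "code_matroid C = vector_matroid (SOME G. generator_matrix C G)"

lemma generator_matrix_exists:
  fixes C :: "('a::field ^ 'n::finite) set"
  assumes "vec.subspace C"
  shows "\<exists>G. generator_matrix C G"
proof -
  obtain B where B: "B \<subseteq> C" "vec.independent B" "C \<subseteq> vec.span B"
    by (rule vec.basis_exists)
  have "finite B" using B(2) by (rule vec.finiteI_independent)
  then obtain G where G: "set G = B" "distinct G" using finite_distinct_list by blast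
  have "vec.span B = C"
    using vec.span_minimal[OF B(1) assms] B(3) by (rule subset_antisym)
  then have "generator_matrix C G" using G B(2) by (simp add: generator_matrix_def)
  then show ?thesis ..
qed

lemma generator_matrix_length:
  assumes "generator_matrix C G"
  shows "length G = vec.dim C"
  using assms vec.dim_span_eq_card_independent[of "set G"] distinct_card[of G]
  by (auto simp: generator_matrix_def)

lemma columns_relation_iff:
  fixes C :: "('a::field ^ 'n::finite) set"
  assumes "generator_matrix C G"
  shows "(\<forall>i<length G. (\<Sum>j\<in>I. c j * G ! i $ j) = 0) \<longleftrightarrow> (\<forall>v\<in>C. (\<Sum>j\<in>I. c j * v $ j) = 0)"
    (is "?L \<longleftrightarrow> ?R")
proof
  let ?S = "{v :: 'a ^ 'n. (\<Sum>j\<in>I. c j * v $ j) = 0}"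
  assume ?L
  then have "set G \<subseteq> ?S" by (auto simp: in_set_conv_nth)
  moreover have "vec.subspace ?S"
  proof (rule vec.subspaceI)
    fix a :: 'a and v :: "'a ^ 'n" assume "v \<in> ?S"
    moreover have "(\<Sum>j\<in>I. c j * (a *s v) $ j) = a * (\<Sum>j\<in>I. c j * v $ j)"
      by (simp add: sum_distrib_left mult.left_commute)
    ultimately show "a *s v \<in> ?S" by simp
  qed (auto simp: distrib_left sum.distrib)
  ultimately have "vec.span (set G) \<subseteq> ?S" by (rule vec.span_minimal)
  then show ?R using assms unfolding generator_matrix_def by auto
next
  assume ?R
  moreover have "set G \<subseteq> C"
    using assms vec.span_superset unfolding generator_matrix_def by blast
  ultimately show ?L by (auto dest: nth_mem)
qed

lemma code_matroid_eq:
  fixes C :: "('a::field ^ 'n::finite) set"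
  assumes "generator_matrix C G"
  shows "code_matroid C = vector_matroid G"
proof -
  define H where "H = (SOME H. generator_matrix C H)"
  have H: "generator_matrix C H" unfolding H_def using assms by (rule someI)
  have "columns_independent H I \<longleftrightarrow> columns_independent G I" for I
    unfolding columns_independent_def columns_relation_iff[OF H] columns_relation_iff[OF assms] ..
  then show ?thesis
    unfolding code_matroid_def vector_matroid_def H_def[symmetric] by blast
qed

text \<open>
  In the following proof a column is encoded as the polynomial with these coefficients, so that it
  lives in a vector space.
\<close>

lemma matroid_vector_matroid:
  fixes G :: "('a::field ^ 'n::finite) list"
  shows "matroid (vector_matroid G)"
proof -
  interpret F: vector_space "smult :: 'a \<Rightarrow> 'a poly \<Rightarrow> 'a poly"
    by unfold_locales (auto simp: smult_add_left smult_add_right)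
  define g where "g j = Poly (map (\<lambda>v. v $ j) G)" for j
  have rel: "(\<forall>i<length G. (\<Sum>j\<in>I. c j * G ! i $ j) = 0) \<longleftrightarrow> (\<Sum>j\<in>I. smult (c j) (g j)) = 0"
    for I and c :: "'n \<Rightarrow> 'a"
  proof -
    have "coeff (\<Sum>j\<in>I. smult (c j) (g j)) i = (if i < length G then \<Sum>j\<in>I. c j * G ! i $ j else 0)"
      for i by (simp add: g_def coeff_sum nth_default_def)
    then show ?thesis by (auto simp: poly_eq_iff)
  qed
  have ci: "columns_independent G I \<longleftrightarrow>
      (\<forall>c. (\<Sum>j\<in>I. smult (c j) (g j)) = 0 \<longrightarrow> (\<forall>j\<in>I. c j = 0))" for I
    unfolding columns_independent_def by (simp only: rel)
  have empty: "columns_independent G {}" by (simp add: columns_independent_def)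
  have mono: "columns_independent G I" if J: "columns_independent G J" and "I \<subseteq> J" for I J
    unfolding ci
  proof (intro allI impI)
    fix c assume c: "(\<Sum>j\<in>I. smult (c j) (g j)) = 0"
    have "(\<Sum>j\<in>J. smult (if j \<in> I then c j else 0) (g j)) = (\<Sum>j\<in>I. smult (c j) (g j))"
      using \<open>I \<subseteq> J\<close>
      by (intro sum.mono_neutral_cong_right) auto
    with c have "\<forall>j\<in>J. (if j \<in> I then c j else 0) = 0"
      using J[unfolded ci, rule_format, of "\<lambda>j. if j \<in> I then c j else 0"] by simp
    then have "(if j \<in> I then c j else 0) = 0" if "j \<in> I" for j
      using that \<open>I \<subseteq> J\<close> by blast
    then show "\<forall>j\<in>I. c j = 0" by simp
  qed
  have ind: "columns_independent G I \<longleftrightarrow> inj_on g I \<and> F.independent (g ` I)" for I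
  proof
    assume I: "columns_independent G I"
    have inj: "inj_on g I"
    proof (rule inj_onI, rule ccontr)
      fix a b assume ab: "a \<in> I" "b \<in> I" "g a = g b" "a \<noteq> b"
      define c where "c j = (if j = a then 1 else if j = b then -1 else 0 :: 'a)" for j
      have "columns_independent G {a, b}" using mono[OF I] ab by simp
      moreover have "(\<Sum>j\<in>{a, b}. smult (c j) (g j)) = 0"
        using ab by (simp add: c_def)
      ultimately have "c a = 0" unfolding ci by (elim allE[of _ c]) simp
      then show False by (simp add: c_def)
    qed
    moreover have "F.independent (g ` I)"
    proof (rule F.independent_if_scalars_zero)
      show "finite (g ` I)" by simp
      fix u x assume u: "(\<Sum>x\<in>g ` I. smult (u x) x) = 0" and x: "x \<in> g ` I"
      have "(\<Sum>j\<in>I. smult (u (g j)) (g j)) = 0"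
        using u inj by (simp add: sum.reindex)
      then have "\<forall>j\<in>I. u (g j) = 0" using I[unfolded ci, THEN spec, of "\<lambda>j. u (g j)"] by simp
      then show "u x = 0" using x by blast
    qed
    ultimately show "inj_on g I \<and> F.independent (g ` I)" ..
  next
    assume I: "inj_on g I \<and> F.independent (g ` I)"
    show "columns_independent G I" unfolding ci
    proof (intro allI impI ballI)
      fix c j assume c: "(\<Sum>j\<in>I. smult (c j) (g j)) = 0" and j: "j \<in> I"
      define u where "u x = c (the_inv_into I g x)" for x
      have "(\<Sum>x\<in>g ` I. smult (u x) x) = (\<Sum>j\<in>I. smult (c j) (g j))"
        using I by (simp add: sum.reindex u_def the_inv_into_f_f)
      then have "u (g j) = 0"
        using F.independentD[of "g ` I" "g ` I" u "g j"] I c j by simp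
      then show "c j = 0" using I j by (simp add: u_def the_inv_into_f_f)
    qed
  qed
  have augment: "\<exists>e\<in>J - I. columns_independent G (insert e I)"
    if I: "columns_independent G I" and J: "columns_independent G J" and lt: "card I < card J"
    for I J
  proof -
    have "\<not> g ` J \<subseteq> F.span (g ` I)"
    proof
      assume "g ` J \<subseteq> F.span (g ` I)"
      then have "card (g ` J) \<le> card (g ` I)"
        using F.independent_span_bound[of "g ` I" "g ` J"] J ind by simp
      then show False using lt I J ind by (simp add: card_image)
    qed
    then obtain e where e: "e \<in> J" "g e \<notin> F.span (g ` I)" by blast
    then have "g e \<notin> g ` I" using F.span_base by blast
    then have "e \<notin> I" by blast
    moreover have "F.independent (insert (g e) (g ` I))"
      using F.independent_insertI e(2) I ind by blast
    moreover have "inj_on g (insert e I)" using I ind \<open>g e \<notin> g ` I\<close> by auto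
    ultimately show ?thesis using e(1) unfolding ind by auto
  qed
  show ?thesis
    unfolding matroid_def vector_matroid_def mem_Collect_eq
  proof (intro conjI allI impI)
    show "columns_independent G {}" by (rule empty)
    show "columns_independent G I" if "columns_independent G J \<and> I \<subseteq> J" for I J
      using that mono by (elim conjE)
    show "\<exists>e\<in>J - I. columns_independent G (insert e I)"
      if "columns_independent G I \<and> columns_independent G J \<and> card I < card J" for I J
      using that by (elim conjE) (rule augment)
  qed
qed


lemma matroid_code_matroid:
  fixes C :: "('a::field ^ 'n::finite) set"
  shows "matroid (code_matroid C)"
  unfolding code_matroid_def by (rule matroid_vector_matroid)


section \<open>Gaussian binomial coefficients\<close>

definition q_bracket :: "nat \<Rightarrow> nat \<Rightarrow> nat \<Rightarrow> real" where
  "q_bracket q a b = (\<Prod>i<b. real q ^ a - real q ^ i)"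

definition gauss_binomial :: "nat \<Rightarrow> nat \<Rightarrow> nat \<Rightarrow> real" where
  "gauss_binomial q a b = q_bracket q a b / q_bracket q b b"

end

theory Submission
  imports Defs
begin

text \<open>
  Both sides equal the sum, over all sets \<open>Y\<close> of coordinates, of
  \<open>B(Y) f~(Y) y^(|Y| - d) (x - y)^(n - |Y| - d)\<close>, where \<open>f~\<close> is \<open>harm_tilde d f\<close> and \<open>B(Y)\<close> is the
  number of \<open>r\<close>-dimensional subcodes of \<open>C\<close> with support inside \<open>Y\<close>.

  On the code side, writing \<open>B(Y)\<close> as a sum over subcodes \<open>D\<close> and exchanging the sums leaves, for each
  \<open>D\<close>, a sum over the supersets \<open>Y\<close> of \<open>S = Supp D\<close>.  For constant \<open>f~\<close> such a sum is a plain
  binomial expansion; that a harmonic \<open>f\<close> only shifts the exponents by \<open>d\<close>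
  (\<open>harm_tilde_sum_supersets\<close>) rests on the identity
  \<open>\<Sum>Z. f(Z) a^|Z \<inter> S| b^|Z - S| = (a - b)^d f~(S)\<close> (\<open>harmonic_generating_function\<close>).  The special
  case \<open>a = 0\<close>, \<open>b = 1\<close> says \<open>f~(E - Y) = (-1)^d f~(Y)\<close>, so that \<open>f~\<close> vanishes on sets with fewer than
  \<open>d\<close> or more than \<open>n - d\<close> elements and no negative exponent ever matters.

  On the Tutte side, the substitution turns the exponent of \<open>x - 1\<close> into a power of
  \<open>q^j\<close> with exponent \<open>k - \<rho>(X)\<close>, which is the dimension \<open>m\<close> of the subcode vanishing on \<open>X\<close>
  (\<open>dim_shortened\<close>).  Passing to the complement \<open>Y = E - X\<close> brings in the sign \<open>(-1)^d\<close>, and the sum over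
  \<open>j\<close> becomes, by the Gaussian binomial theorem at \<open>t = q^m\<close>, the product
  \<open>[m,r] = \<Prod>i<r. q^m - q^i\<close>.  Divided by \<open>[r]\<close> this is the number of \<open>r\<close>-dimensional subspaces of an
  \<open>m\<close>-dimensional space (\<open>card_subcodes\<close>), that is, \<open>B(Y)\<close>.
\<close>

section \<open>Harmonic functions\<close>

text \<open>
  Harmonicity propagates downwards from \<open>(d - 1)\<close>-sets: adding up the sums attached to
  \<open>insert e T\<close> over all \<open>e \<notin> T\<close> counts every \<open>Z \<supseteq> T\<close> exactly \<open>d - card T\<close> times.
\<close>

lemma harmonic_sum_supersets:
  fixes f :: "'n::finite set \<Rightarrow> real"
  assumes "harmonic d f" and "card T < d"
  shows "(\<Sum>Z | card Z = d \<and> T \<subseteq> Z. f Z) = 0"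
  using assms(2)
proof (induction "d - card T" arbitrary: T)
  case 0
  then show ?case by simp
next
  case (Suc m)
  show ?case
  proof (cases "card T = d - 1")
    case True
    then show ?thesis using assms(1) by (simp add: harmonic_def)
  next
    case False
    with Suc have lt: "card T + 1 < d" by linarith
    have zero: "(\<Sum>Z | card Z = d \<and> insert e T \<subseteq> Z. f Z) = 0" if "e \<notin> T" for e
    proof -
      have "card (insert e T) = card T + 1" using that by simp
      then show ?thesis using Suc lt by (intro Suc.hyps(1)) auto
    qed
    have "real (d - card T) * (\<Sum>Z | card Z = d \<and> T \<subseteq> Z. f Z)
        = (\<Sum>Z | card Z = d \<and> T \<subseteq> Z. \<Sum>e\<in>Z - T. f Z)"
      unfolding sum_distrib_left
      by (intro sum.cong) (auto simp: card_Diff_subset)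
    also have "\<dots> = (\<Sum>Z | card Z = d \<and> T \<subseteq> Z. \<Sum>e | e \<in> - T \<and> e \<in> Z. f Z)"
      by (intro sum.cong) auto
    also have "\<dots> = (\<Sum>e\<in>- T. \<Sum>Z | Z \<in> {Z. card Z = d \<and> T \<subseteq> Z} \<and> e \<in> Z. f Z)"
      by (rule sum.swap_restrict) simp_all
    also have "\<dots> = (\<Sum>e\<in>- T. \<Sum>Z | card Z = d \<and> insert e T \<subseteq> Z. f Z)"
      by (intro sum.cong) auto
    also have "\<dots> = 0" using zero by simp
    finally show ?thesis using lt by simp
  qed
qed

lemma sum_power_subsets:
  fixes a b :: "'b::comm_ring_1"
  assumes "finite S"
  shows "(\<Sum>T\<in>Pow S. a ^ card T * b ^ (card S - card T)) = (a + b) ^ card S"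
proof -
  have "(a + b) ^ card S = (\<Sum>T\<in>Pow S. (\<Prod>_\<in>T. a) * (\<Prod>_\<in>S - T. b))"
    using prod_add[OF assms, of "\<lambda>_. a" "\<lambda>_. b"] by simp
  also have "\<dots> = (\<Sum>T\<in>Pow S. a ^ card T * b ^ (card S - card T))"
    using assms by (intro sum.cong) (auto simp: card_Diff_subset finite_subset)
  finally show ?thesis by simp
qed

text \<open>
  Expanding \<open>a ^ card (Z \<inter> Y) = ((a - b) + b) ^ card (Z \<inter> Y)\<close> over the subsets \<open>T\<close> of \<open>Z \<inter> Y\<close> makes
  the coefficient depend on \<open>T\<close> alone, because all \<open>Z\<close> have the same size.  The sum over
  \<open>Z \<supseteq> T\<close> is then zero for \<open>card T < d\<close>, and only \<open>T = Z \<subseteq> Y\<close> is left.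
\<close>

lemma harmonic_generating_function:
  fixes g :: "'n::finite set \<Rightarrow> 'b::comm_ring_1"
  assumes g: "\<And>T. card T < d \<Longrightarrow> (\<Sum>Z | card Z = d \<and> T \<subseteq> Z. g Z) = 0"
  shows "(\<Sum>Z | card Z = d. g Z * a ^ card (Z \<inter> Y) * b ^ card (Z - Y))
       = (a - b) ^ d * (\<Sum>Z | card Z = d \<and> Z \<subseteq> Y. g Z)"
proof -
  have expand: "a ^ card (Z \<inter> Y) * b ^ card (Z - Y)
      = (\<Sum>T | T \<in> Pow Y \<and> T \<subseteq> Z. (a - b) ^ card T * b ^ (d - card T))"
    if "card Z = d" for Z
  proof -
    have cZ: "d = card (Z \<inter> Y) + card (Z - Y)"
      using that card_Un_disjoint[of "Z \<inter> Y" "Z - Y"]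
      by (simp add: Int_Diff_Un Int_Diff_disjoint)
    have "a ^ card (Z \<inter> Y) * b ^ card (Z - Y)
        = (\<Sum>T\<in>Pow (Z \<inter> Y). (a - b) ^ card T * b ^ (card (Z \<inter> Y) - card T)) * b ^ card (Z - Y)"
      by (subst sum_power_subsets) simp_all
    also have "\<dots> = (\<Sum>T\<in>Pow (Z \<inter> Y). (a - b) ^ card T * b ^ (d - card T))"
      unfolding sum_distrib_right
    proof (intro sum.cong refl)
      fix T assume "T \<in> Pow (Z \<inter> Y)"
      then have "card T \<le> card (Z \<inter> Y)" by (intro card_mono) auto
      then have "d - card T = (card (Z \<inter> Y) - card T) + card (Z - Y)" using cZ by simp
      then show "(a - b) ^ card T * b ^ (card (Z \<inter> Y) - card T) * b ^ card (Z - Y)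
          = (a - b) ^ card T * b ^ (d - card T)" by (simp add: power_add mult.assoc)
    qed
    also have "Pow (Z \<inter> Y) = {T. T \<in> Pow Y \<and> T \<subseteq> Z}" by auto
    finally show ?thesis .
  qed
  have "(\<Sum>Z | card Z = d. g Z * a ^ card (Z \<inter> Y) * b ^ card (Z - Y))
      = (\<Sum>Z | card Z = d. \<Sum>T | T \<in> Pow Y \<and> T \<subseteq> Z. g Z * ((a - b) ^ card T * b ^ (d - card T)))"
    by (intro sum.cong refl) (simp add: expand sum_distrib_left mult.assoc)
  also have "\<dots> = (\<Sum>T\<in>Pow Y. \<Sum>Z | Z \<in> {Z. card Z = d} \<and> T \<subseteq> Z.
      g Z * ((a - b) ^ card T * b ^ (d - card T)))"
    by (rule sum.swap_restrict) simp_all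
  also have "\<dots> = (\<Sum>T\<in>Pow Y. if card T = d then (a - b) ^ d * g T else 0)"
  proof (intro sum.cong refl)
    fix T assume "T \<in> Pow Y"
    consider "card T < d" | "card T = d" | "card T > d" by linarith
    then show "(\<Sum>Z | Z \<in> {Z. card Z = d} \<and> T \<subseteq> Z. g Z * ((a - b) ^ card T * b ^ (d - card T)))
        = (if card T = d then (a - b) ^ d * g T else 0)"
    proof cases
      case 1
      then show ?thesis using g[of T] by (simp flip: sum_distrib_right)
    next
      case 2
      have "{Z. Z \<in> {Z. card Z = d} \<and> T \<subseteq> Z} = {T}"
        using 2 by (auto dest: card_subset_eq[rotated])
      then show ?thesis using 2 by (simp add: mult.commute)
    next
      case 3
      have "{Z. Z \<in> {Z. card Z = d} \<and> T \<subseteq> Z} = {}"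
        using 3 by (auto dest: card_mono[rotated])
      then have "sum h {Z. Z \<in> {Z. card Z = d} \<and> T \<subseteq> Z} = 0" for h :: "'n set \<Rightarrow> 'b"
        by (simp only: sum.empty)
      then show ?thesis using 3 by simp
    qed
  qed
  also have "\<dots> = (\<Sum>Z | card Z = d \<and> Z \<subseteq> Y. (a - b) ^ d * g Z)"
    by (intro sum.mono_neutral_cong_right) auto
  finally show ?thesis by (simp add: sum_distrib_left)
qed

lemma card_compl: "card (- Y) = CARD('n) - card (Y :: 'n::finite set)"
  by (simp add: Compl_eq_Diff_UNIV card_Diff_subset)

lemma harm_tilde_Compl:
  fixes f :: "'n::finite set \<Rightarrow> real"
  assumes "harmonic d f"
  shows "harm_tilde d f (- Y) = (- 1) ^ d * harm_tilde d f Y"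
proof -
  have "harm_tilde d f (- Y) = (\<Sum>Z | card Z = d. f Z * 0 ^ card (Z \<inter> Y) * 1 ^ card (Z - Y))"
    unfolding harm_tilde_def
    by (intro sum.mono_neutral_cong_left) (auto simp: power_0_left)
  also have "\<dots> = (0 - 1) ^ d * (\<Sum>Z | card Z = d \<and> Z \<subseteq> Y. f Z)"
    by (rule harmonic_generating_function) (rule harmonic_sum_supersets[OF assms])
  finally show ?thesis by (simp add: harm_tilde_def)
qed

text \<open>
  A set with fewer than \<open>d\<close> elements has no \<open>d\<close>-subsets; complementation gives the upper bound.
\<close>

lemma harm_tilde_eq_0:
  fixes f :: "'n::finite set \<Rightarrow> real"
  assumes "harmonic d f" and "card X < d \<or> CARD('n) < card X + d"
  shows "harm_tilde d f X = 0"
proof -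
  have small: "harm_tilde d f Y = 0" if "card Y < d" for Y
  proof -
    have "{Z. card Z = d \<and> Z \<subseteq> Y} = {}" using that by (auto dest: card_mono[rotated])
    then show ?thesis by (simp only: harm_tilde_def sum.empty)
  qed
  show ?thesis
  proof (cases "card X < d")
    case False
    with assms(2) have "card (- X) < d"
      using card_mono[of UNIV X] unfolding card_compl by simp
    from small[OF this] show ?thesis by (simp add: harm_tilde_Compl[OF assms(1)])
  qed (rule small)
qed

section \<open>Counting subspaces\<close>

lemma card_span_independent:
  fixes B :: "('a::{field,finite} ^ 'n::finite) set"
  assumes "vec.independent B"
  shows "card (vec.span B) = CARD('a) ^ card B"
proof -
  have "finite B" using assms by (rule vec.finiteI_independent)
  then show ?thesis using assms
  proof (induction B)
    case empty
    then show ?case by simp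
  next
    case (insert b B)
    then have B: "vec.independent B" and b: "b \<notin> vec.span B"
      by (auto simp: vec.independent_insert)
    let ?h = "\<lambda>(c, v). c *s b + v"
    have "inj_on ?h (UNIV \<times> vec.span B)"
    proof (rule inj_onI, clarify)
      fix c v c' v'
      assume v: "v \<in> vec.span B" "v' \<in> vec.span B" and eq: "c *s b + v = c' *s b + v'"
      have "(c - c') *s b = v' - v" using eq by (simp add: algebra_simps vec.scale_left_diff_distrib)
      then have "(c - c') *s b \<in> vec.span B" using v by (simp add: vec.span_diff)
      have "c = c'"
      proof (rule ccontr)
        assume "c \<noteq> c'"
        then have "b = inverse (c - c') *s ((c - c') *s b)" by (simp only: vec.scale_scale) simp
        then show False using b vec.span_scale[OF \<open>(c - c') *s b \<in> vec.span B\<close>] by metis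
      qed
      then show "c = c' \<and> v = v'" using eq by simp
    qed
    moreover have "?h ` (UNIV \<times> vec.span B) = vec.span (insert b B)"
    proof
      show "?h ` (UNIV \<times> vec.span B) \<subseteq> vec.span (insert b B)"
        by (auto intro!: vec.span_add vec.span_scale intro: vec.span_base
            subsetD[OF vec.span_mono[OF subset_insertI]])
      show "vec.span (insert b B) \<subseteq> ?h ` (UNIV \<times> vec.span B)"
      proof
        fix x assume "x \<in> vec.span (insert b B)"
        then obtain c where "x - c *s b \<in> vec.span B" by (auto simp: vec.span_insert)
        then show "x \<in> ?h ` (UNIV \<times> vec.span B)"
          by (intro image_eqI[of _ _ "(c, x - c *s b)"]) auto
      qed
    qed
    ultimately have "card (vec.span (insert b B)) = card (UNIV \<times> vec.span B :: ('a \<times> _) set)"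
      using card_image by metis
    then show ?case using insert B by (simp add: card_cartesian_product)
  qed
qed

lemma card_subspace:
  fixes V :: "('a::{field,finite} ^ 'n::finite) set"
  assumes "vec.subspace V"
  shows "card V = CARD('a) ^ vec.dim V"
proof -
  obtain B where B: "B \<subseteq> V" "vec.independent B" "V \<subseteq> vec.span B" "card B = vec.dim V"
    by (rule vec.basis_exists)
  have "vec.span B = V"
    using vec.span_minimal[OF B(1) assms] B(3) by (rule subset_antisym)
  then show ?thesis using card_span_independent[OF B(2)] B(4) by simp
qed

text \<open>
  A subspace of dimension \<open>r\<close> is counted through its ordered bases, so linearly independent
  lists are used in place of sets.
\<close>

definition frames :: "nat \<Rightarrow> ('a::field ^ 'n::finite) set \<Rightarrow> ('a ^ 'n) list set" where
  "frames r V = {l. length l = r \<and> distinct l \<and> vec.independent (set l) \<and> set l \<subseteq> V}"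

lemma finite_frames: "finite (frames r (V :: ('a::{field,finite} ^ 'n::finite) set))"
  by (rule finite_subset[OF _ finite_lists_length_eq[of UNIV r]]) (auto simp: frames_def)

text \<open>
  A frame of length \<open>r\<close> extends by any vector outside its span, which leaves \<open>q^m - q^r\<close> choices.
\<close>

lemma card_frames:
  fixes V :: "('a::{field,finite} ^ 'n::finite) set"
  assumes V: "vec.subspace V"
  shows "real (card (frames r V)) = q_bracket CARD('a) (vec.dim V) r"
proof (induction r)
  case 0
  have "frames 0 V = {[]}" by (auto simp: frames_def vec.independent_empty)
  then show ?case by (simp add: q_bracket_def)
next
  case (Suc r)
  let ?S = "SIGMA l : frames r V. V - vec.span (set l)"
  have "bij_betw (\<lambda>(l, v). v # l) ?S (frames (Suc r) V)"
    unfolding bij_betw_def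
  proof
    show "inj_on (\<lambda>(l, v). v # l) ?S" by (auto simp: inj_on_def)
    show "(\<lambda>(l, v). v # l) ` ?S = frames (Suc r) V"
    proof
      show "(\<lambda>(l, v). v # l) ` ?S \<subseteq> frames (Suc r) V"
        by (clarsimp simp: frames_def vec.independent_insertI) (blast intro: vec.span_base)
      show "frames (Suc r) V \<subseteq> (\<lambda>(l, v). v # l) ` ?S"
      proof
        fix m assume m: "m \<in> frames (Suc r) V"
        then obtain v l where "m = v # l" by (cases m) (auto simp: frames_def)
        then show "m \<in> (\<lambda>(l, v). v # l) ` ?S"
          using m by (intro image_eqI[of _ _ "(l, v)"]) (auto simp: frames_def vec.independent_insert)
      qed
    qed
  qed
  then have "real (card (frames (Suc r) V)) = real (card ?S)"
    by (simp add: bij_betw_same_card)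
  also have "\<dots> = (\<Sum>l\<in>frames r V. real (card (V - vec.span (set l))))"
    by (simp add: card_SigmaI finite_frames)
  also have "\<dots> = (\<Sum>l\<in>frames r V. real CARD('a) ^ vec.dim V - real CARD('a) ^ r)"
  proof (intro sum.cong refl)
    fix l assume l: "l \<in> frames r V"
    then have sub: "vec.span (set l) \<subseteq> V" using V by (auto simp: frames_def vec.span_minimal)
    have "card (vec.span (set l)) = CARD('a) ^ r"
      using l card_span_independent[of "set l"] by (auto simp: frames_def distinct_card)
    moreover have "card V = CARD('a) ^ vec.dim V" using V by (rule card_subspace)
    ultimately show "real (card (V - vec.span (set l))) = real CARD('a) ^ vec.dim V - real CARD('a) ^ r"
      using sub card_mono[OF _ sub] by (simp add: card_Diff_subset of_nat_diff)
  qed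
  also have "\<dots> = q_bracket CARD('a) (vec.dim V) (Suc r)"
    using Suc by (simp add: q_bracket_def)
  finally show ?case .
qed

lemma one_less_card_field: "1 < CARD('a::{field,finite})"
  using card_mono[of "UNIV :: 'a set" "{0, 1}"] by simp

lemma q_bracket_self_nonzero: "1 < q \<Longrightarrow> q_bracket q r r \<noteq> 0"
  by (auto simp: q_bracket_def power_inject_exp)

text \<open>
  The frames of \<open>V\<close> are partitioned according to their spans, and each \<open>r\<close>-dimensional subspace
  contributes \<open>[r,r]\<close> of them.
\<close>

lemma card_subcodes:
  fixes V :: "('a::{field,finite} ^ 'n::finite) set"
  assumes V: "vec.subspace V"
  shows "real (card (subcodes r V)) = gauss_binomial CARD('a) (vec.dim V) r"
proof -
  have frames_eq: "frames r V = (\<Union>D\<in>subcodes r V. frames r D)"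
  proof
    show "(\<Union>D\<in>subcodes r V. frames r D) \<subseteq> frames r V"
      by (auto simp: frames_def subcodes_def)
    show "frames r V \<subseteq> (\<Union>D\<in>subcodes r V. frames r D)"
    proof
      fix l assume l: "l \<in> frames r V"
      then have "vec.span (set l) \<in> subcodes r V" "l \<in> frames r (vec.span (set l))"
        using V by (auto simp: frames_def subcodes_def vec.span_minimal vec.span_base
            vec.dim_eq_card_independent distinct_card)
      then show "l \<in> (\<Union>D\<in>subcodes r V. frames r D)" by blast
    qed
  qed
  have span: "vec.span (set l) = D" if "D \<in> subcodes r V" "l \<in> frames r D" for D l
  proof -
    have D: "vec.subspace D" "vec.dim D = r"
      and l: "set l \<subseteq> D" "vec.independent (set l)" "card (set l) = r"
      using that by (auto simp: subcodes_def frames_def distinct_card)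
    have "D \<subseteq> vec.span (set l)"
      using D l by (intro vec.card_ge_dim_independent) auto
    then show ?thesis using vec.span_minimal[OF l(1) D(1)] by blast
  qed
  have "card (frames r V) = (\<Sum>D\<in>subcodes r V. card (frames r D))"
    unfolding frames_eq
  proof (rule card_UN_disjoint)
    show "\<forall>D\<in>subcodes r V. \<forall>D'\<in>subcodes r V. D \<noteq> D' \<longrightarrow> frames r D \<inter> frames r D' = {}"
      using span by blast
  qed (simp_all add: finite_frames)
  then have "real (card (frames r V)) = (\<Sum>D\<in>subcodes r V. real (card (frames r D)))" by simp
  also have "\<dots> = (\<Sum>D\<in>subcodes r V. q_bracket CARD('a) r r)"
    by (intro sum.cong refl) (simp add: subcodes_def card_frames)
  finally have "q_bracket CARD('a) (vec.dim V) r = real (card (subcodes r V)) * q_bracket CARD('a) r r"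
    by (simp add: card_frames[OF V])
  then show ?thesis
    using q_bracket_self_nonzero[of "CARD('a)" r] one_less_card_field[where 'a = 'a]
    by (simp add: gauss_binomial_def)
qed

section \<open>The Gaussian binomial theorem\<close>

lemma q_bracket_Suc_Suc:
  "q_bracket q (Suc a) (Suc b) = (real q ^ Suc a - 1) * real q ^ b * q_bracket q a b"
proof -
  have "q_bracket q (Suc a) (Suc b) = (real q ^ Suc a - 1) * (\<Prod>i<b. real q * (real q ^ a - real q ^ i))"
    unfolding q_bracket_def by (subst prod.lessThan_Suc_shift) (simp add: algebra_simps)
  then show ?thesis by (simp add: prod.distrib q_bracket_def)
qed

text \<open>
  The version of the Pascal rule with the power of \<open>q\<close> on the second summand is the one matched by
  the signs and powers in the binomial theorem below.
\<close>

lemma gauss_binomial_Suc_Suc: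
  assumes q: "1 < q"
  shows "gauss_binomial q (Suc a) (Suc b)
       = gauss_binomial q a b + real q ^ Suc b * gauss_binomial q a (Suc b)"
proof -
  have ne: "q_bracket q b b \<noteq> 0" using q by (rule q_bracket_self_nonzero)
  have q1: "real q ^ Suc b - 1 \<noteq> 0" and q0: "real q ^ b \<noteq> 0"
    using q power_inject_exp[of "real q" "Suc b" 0] by simp_all
  define u v B G where "u = real q ^ b" and "v = real q ^ a"
    and "B = q_bracket q b b" and "G = q_bracket q a b"
  note nz = ne[folded B_def] q1[unfolded power_Suc, folded u_def] q0[folded u_def]
  have "G / B + real q * u * (G * (v - u) / ((real q * u - 1) * u * B))
      = (real q * v - 1) * u * G / ((real q * u - 1) * u * B)"
    using nz by (simp add: divide_simps) algebra
  moreover have "q_bracket q a (Suc b) = G * (v - u)"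
    by (simp add: q_bracket_def G_def u_def v_def)
  ultimately show ?thesis
    unfolding gauss_binomial_def q_bracket_Suc_Suc
    by (simp add: u_def v_def B_def G_def)
qed

lemma gauss_binomial_0 [simp]: "gauss_binomial q a 0 = 1"
  by (simp add: gauss_binomial_def q_bracket_def)

lemma gauss_binomial_eq_0: "a < b \<Longrightarrow> gauss_binomial q a b = 0"
  by (auto simp: gauss_binomial_def q_bracket_def)

text \<open>
  Multiplying the product for \<open>r\<close> by \<open>t - q^r\<close> acts on coefficients as the Pascal rule, since
  \<open>(r - j choose 2) + r = (r + 1 - j choose 2) + j\<close>.
\<close>

theorem gauss_binomial_theorem:
  fixes t :: real
  assumes q: "1 < q"
  shows "(\<Sum>j\<le>r. gauss_binomial q r j * (-1) ^ (r - j) * real q ^ ((r - j) choose 2) * t ^ j)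
       = (\<Prod>i<r. t - real q ^ i)"
proof (induction r)
  case 0
  then show ?case by (simp add: binomial_eq_0)
next
  case (Suc r)
  define s where "s m = (-1) ^ m * real q ^ (m choose 2)" for m :: nat
  let ?P = "\<lambda>r j. gauss_binomial q r j * s (r - j) * t ^ j"
  have choose: "Suc m choose 2 = (m choose 2) + m" for m
    by (simp add: numeral_2_eq_2)
  have s_Suc: "real q ^ Suc j * s (r - j) = - (real q ^ r * s (r - Suc j))" if "j < r" for j
  proof -
    define m where "m = r - Suc j"
    have "r - j = Suc m" "r = Suc j + m" using that by (auto simp: m_def)
    then show ?thesis by (simp add: s_def choose power_add)
  qed
  have "(\<Sum>j\<le>Suc r. ?P (Suc r) j) = s (Suc r) + (\<Sum>j\<le>r. gauss_binomial q r j * s (r - j) * t ^ Suc j)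
      + (\<Sum>j\<le>r. gauss_binomial q r (Suc j) * (real q ^ Suc j * s (r - j)) * t ^ Suc j)"
    by (subst sum.atMost_Suc_shift)
      (simp add: gauss_binomial_Suc_Suc[OF q] algebra_simps sum.distrib)
  also have "(\<Sum>j\<le>r. gauss_binomial q r (Suc j) * (real q ^ Suc j * s (r - j)) * t ^ Suc j)
      = (\<Sum>j\<le>r. - (real q ^ r * ?P r (Suc j)))"
  proof (intro sum.cong refl)
    fix j assume "j \<in> {..r}"
    show "gauss_binomial q r (Suc j) * (real q ^ Suc j * s (r - j)) * t ^ Suc j = - (real q ^ r * ?P r (Suc j))"
    proof (cases "j < r")
      case True
      show ?thesis unfolding s_Suc[OF True] by simp
    next
      case False
      then show ?thesis by (simp add: gauss_binomial_eq_0)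
    qed
  qed
  also have "s (Suc r) = - (real q ^ r * ?P r 0)"
    by (simp add: s_def choose power_add)
  also have "- (real q ^ r * ?P r 0) + (\<Sum>j\<le>r. gauss_binomial q r j * s (r - j) * t ^ Suc j)
      + (\<Sum>j\<le>r. - (real q ^ r * ?P r (Suc j)))
      = t * (\<Sum>j\<le>r. ?P r j) - real q ^ r * (\<Sum>j\<le>Suc r. ?P r j)"
    by (subst sum.atMost_Suc_shift[of _ r])
      (simp add: sum_distrib_left sum_negf algebra_simps)
  also have "\<dots> = (t - real q ^ r) * (\<Sum>j\<le>r. ?P r j)"
    by (simp add: gauss_binomial_eq_0 algebra_simps)
  also have "(\<Sum>j\<le>r. ?P r j) = (\<Prod>i<r. t - real q ^ i)"
    using Suc.IH by (simp add: s_def mult.assoc)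
  finally have "(\<Sum>j\<le>Suc r. ?P (Suc r) j) = (\<Prod>i<Suc r. t - real q ^ i)"
    by (simp only: prod.lessThan_Suc mult.commute)
  then show ?case by (simp only: s_def mult.assoc)
qed

section \<open>The rank function of the matroid of a code\<close>

lemma code_matroid_iff:
  fixes C :: "('a::field ^ 'n::finite) set"
  assumes "vec.subspace C"
  shows "I \<in> code_matroid C \<longleftrightarrow>
    (\<forall>c. (\<forall>v\<in>C. (\<Sum>j\<in>I. c j * v $ j) = 0) \<longrightarrow> (\<forall>j\<in>I. c j = 0))"
proof -
  obtain G where G: "generator_matrix C G" using generator_matrix_exists[OF assms] ..
  show ?thesis
    unfolding code_matroid_eq[OF G] vector_matroid_def mem_Collect_eq columns_independent_def
      columns_relation_iff[OF G] ..
qed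

text \<open>
  The words of \<open>C\<close> that vanish on \<open>X\<close>, kept at full length so that the result is again a
  subspace of the same type.
\<close>

definition shortened :: "('a::zero ^ 'n) set \<Rightarrow> 'n set \<Rightarrow> ('a ^ 'n) set" where
  "shortened C X = {v \<in> C. \<forall>i\<in>X. v $ i = 0}"

lemma subspace_shortened:
  fixes C :: "('a::field ^ 'n::finite) set"
  assumes "vec.subspace C"
  shows "vec.subspace (shortened C X)"
  using assms unfolding shortened_def vec.subspace_def by auto

lemma shortened_shortened: "shortened (shortened C X) Y = shortened C (X \<union> Y)"
  by (auto simp: shortened_def)

text \<open>
  Duality in coordinates: a coordinate functional that vanishes on the common kernel of others is a linear
  combination of them.  In the induction, \<open>C\<close> is replaced by the words with \<open>v $ i = 0\<close>; a word \<open>w\<close> with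
  \<open>w $ i = 1\<close> serves to move arbitrary words into that subspace and determines the coefficient of
  coordinate \<open>i\<close>.
\<close>

lemma coordinate_combination:
  fixes C :: "('a::field ^ 'n::finite) set"
  assumes "finite I" and "vec.subspace C" and "\<And>v. v \<in> shortened C I \<Longrightarrow> v $ j = 0"
  shows "\<exists>c. \<forall>v\<in>C. v $ j = (\<Sum>i\<in>I. c i * v $ i)"
  using assms
proof (induction I arbitrary: C rule: finite_induct)
  case empty
  then show ?case by (simp add: shortened_def)
next
  case (insert i I)
  let ?C = "shortened C {i}"
  have "\<exists>c. \<forall>v\<in>?C. v $ j = (\<Sum>l\<in>I. c l * v $ l)"
    using insert.prems by (intro insert.IH subspace_shortened) (simp_all add: shortened_shortened)
  then obtain c where c: "v $ j = (\<Sum>l\<in>I. c l * v $ l)" if "v \<in> ?C" for v by blast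
  show ?case
  proof (cases "\<forall>v\<in>C. v $ i = 0")
    case True
    then have "?C = C" by (auto simp: shortened_def)
    then show ?thesis using c insert.hyps True
      by (intro exI[of _ c]) simp
  next
    case False
    then obtain u where u: "u \<in> C" "u $ i \<noteq> 0" by blast
    define w where "w = inverse (u $ i) *s u"
    have w: "w \<in> C" "w $ i = 1" using u insert.prems(1) by (simp_all add: w_def vec.subspace_scale)
    define a where "a = w $ j - (\<Sum>l\<in>I. c l * w $ l)"
    have "v $ j = (\<Sum>l\<in>insert i I. (c(i := a)) l * v $ l)" if v: "v \<in> C" for v
    proof -
      have "v - v $ i *s w \<in> ?C"
        using v w insert.prems(1) by (simp add: shortened_def vec.subspace_diff vec.subspace_scale)
      from c[OF this] have "v $ j = v $ i * w $ j + (\<Sum>l\<in>I. c l * (v $ l - v $ i * w $ l))"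
        by (simp add: algebra_simps)
      also have "(\<Sum>l\<in>I. c l * (v $ l - v $ i * w $ l))
          = (\<Sum>l\<in>I. c l * v $ l) - v $ i * (\<Sum>l\<in>I. c l * w $ l)"
        by (simp add: algebra_simps sum_subtractf sum_distrib_left)
      also have "(\<Sum>l\<in>I. c l * v $ l) = (\<Sum>l\<in>I. (c(i := a)) l * v $ l)"
        using insert.hyps by (intro sum.cong) auto
      finally show ?thesis using insert.hyps by (simp add: a_def algebra_simps)
    qed
    then show ?thesis by blast
  qed
qed

lemma dim_shortened_singleton:
  fixes V :: "('a::field ^ 'n::finite) set"
  assumes V: "vec.subspace V" and w: "w \<in> V" "w $ j \<noteq> 0"
  shows "vec.dim V = vec.dim (shortened V {j}) + 1"
proof -
  let ?K = "shortened V {j}"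
  have K: "vec.subspace ?K" using V by (rule subspace_shortened)
  have "V = vec.span (insert w ?K)"
  proof
    show "vec.span (insert w ?K) \<subseteq> V"
      using V w by (intro vec.span_minimal) (auto simp: shortened_def)
    show "V \<subseteq> vec.span (insert w ?K)"
    proof
      fix v assume v: "v \<in> V"
      have "v - (v $ j / w $ j) *s w \<in> ?K"
        using v w V by (simp add: shortened_def vec.subspace_diff vec.subspace_scale)
      then show "v \<in> vec.span (insert w ?K)"
        unfolding vec.span_insert using vec.span_base by blast
    qed
  qed
  moreover have "w \<notin> vec.span ?K"
    using w K by (simp add: vec.span_eq_iff[THEN iffD2] shortened_def)
  ultimately show ?thesis by (metis vec.dim_insert vec.dim_span)
qed

text \<open>
  Each further independent coordinate cuts the dimension by one: if it were constantly zero on the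
  words vanishing on \<open>I\<close>, it would depend on the coordinates in \<open>I\<close>.
\<close>

lemma dim_shortened_independent:
  fixes C :: "('a::field ^ 'n::finite) set"
  assumes C: "vec.subspace C" and I: "I \<in> code_matroid C"
  shows "vec.dim (shortened C I) + card I = vec.dim C"
proof -
  have "finite I" by simp
  then show ?thesis using I
  proof (induction I rule: finite_induct)
    case empty
    then show ?case by (simp add: shortened_def)
  next
    case (insert j I)
    have "I \<in> code_matroid C"
      using matroid_code_matroid[of C] insert.prems by (auto simp: matroid_def)
    then have IH: "vec.dim (shortened C I) + card I = vec.dim C" by (rule insert.IH)
    have "\<exists>w\<in>shortened C I. w $ j \<noteq> 0"
    proof (rule ccontr)
      assume "\<not> ?thesis"
      then obtain c where c: "v $ j = (\<Sum>i\<in>I. c i * v $ i)" if "v \<in> C" for v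
        using coordinate_combination[OF insert.hyps(1) C, of j] by blast
      let ?c = "c(j := - 1)"
      have "(\<Sum>i\<in>insert j I. ?c i * v $ i) = 0" if "v \<in> C" for v
      proof -
        have "(\<Sum>i\<in>I. ?c i * v $ i) = (\<Sum>i\<in>I. c i * v $ i)"
          using insert.hyps by (intro sum.cong) auto
        then show ?thesis using insert.hyps c[OF that] by simp
      qed
      then have "?c j = 0" using insert.prems unfolding code_matroid_iff[OF C] by blast
      then show False by simp
    qed
    then obtain w where "w \<in> shortened C I" "w $ j \<noteq> 0" by blast
    from dim_shortened_singleton[OF subspace_shortened[OF C] this]
    have "vec.dim (shortened C I) = vec.dim (shortened C (insert j I)) + 1"
      by (simp add: shortened_shortened)
    then show ?case using IH insert.hyps by simp
  qed
qed

lemma matroid_rank_attained: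
  assumes "matroid M"
  obtains I where "I \<in> M" "I \<subseteq> X" "card I = matroid_rank M X"
    and "\<And>J. J \<in> M \<Longrightarrow> J \<subseteq> X \<Longrightarrow> card J \<le> card I"
proof -
  let ?S = "card ` {I. I \<in> M \<and> I \<subseteq> X}"
  have "{} \<in> M" using assms by (simp add: matroid_def)
  then have "?S \<noteq> {}" by blast
  then have "matroid_rank M X \<in> ?S" unfolding matroid_rank_def by (intro Max_in) simp_all
  then obtain I where "I \<in> M" "I \<subseteq> X" "card I = matroid_rank M X" by auto
  moreover have "card J \<le> matroid_rank M X" if "J \<in> M" "J \<subseteq> X" for J
    unfolding matroid_rank_def using that by (intro Max_ge) auto
  ultimately show ?thesis using that by metis
qed

text \<open>
  A maximal independent \<open>I \<subseteq> X\<close> has \<open>\<rho>(X)\<close> elements, and every coordinate in \<open>X\<close> is a combination of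
  those in \<open>I\<close>, so that vanishing on \<open>I\<close> already forces vanishing on \<open>X\<close>.
\<close>

lemma dim_shortened:
  fixes C :: "('a::field ^ 'n::finite) set"
  assumes C: "vec.subspace C"
  shows "vec.dim (shortened C X) + matroid_rank (code_matroid C) X = vec.dim C"
proof -
  obtain I where I: "I \<in> code_matroid C" "I \<subseteq> X" "card I = matroid_rank (code_matroid C) X"
    and max: "\<And>J. J \<in> code_matroid C \<Longrightarrow> J \<subseteq> X \<Longrightarrow> card J \<le> card I"
    using matroid_rank_attained[OF matroid_code_matroid] by blast
  have "v $ j = 0" if v: "v \<in> shortened C I" and j: "j \<in> X" for v j
  proof (cases "j \<in> I")
    case True
    then show ?thesis using v by (simp add: shortened_def)
  next
    case False
    have "insert j I \<notin> code_matroid C" using max[of "insert j I"] I(2) j False by auto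
    then obtain c where c: "\<And>v. v \<in> C \<Longrightarrow> (\<Sum>i\<in>insert j I. c i * v $ i) = 0"
      and nz: "\<exists>i\<in>insert j I. c i \<noteq> 0" unfolding code_matroid_iff[OF C] by blast
    have sum: "c j * u $ j + (\<Sum>i\<in>I. c i * u $ i) = 0" if "u \<in> C" for u
      using c[OF that] False by simp
    have "c j \<noteq> 0"
    proof
      assume "c j = 0"
      then have "\<forall>i\<in>I. c i = 0" using I(1) sum unfolding code_matroid_iff[OF C] by auto
      then show False using nz \<open>c j = 0\<close> by blast
    qed
    moreover have "(\<Sum>i\<in>I. c i * v $ i) = 0" using v by (simp add: shortened_def)
    ultimately show ?thesis using sum[of v] v by (simp add: shortened_def)
  qed
  then have "shortened C X = shortened C I"
    using I(2) by (auto simp: shortened_def)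
  then show ?thesis using dim_shortened_independent[OF C I(1)] I(3) by simp
qed

lemma matroid_rank_UNIV_code:
  fixes C :: "('a::field ^ 'n::finite) set"
  assumes C: "vec.subspace C"
  shows "matroid_rank (code_matroid C) UNIV = vec.dim C"
proof -
  have "shortened C UNIV \<subseteq> {0}" by (auto simp: shortened_def vec_eq_iff)
  then have "vec.dim (shortened C UNIV) = 0" by (simp add: vec.dim_eq_0)
  with dim_shortened[OF C, of UNIV] show ?thesis by linarith
qed

lemma matroid_rank_le_card:
  fixes M :: "'n::finite set set"
  assumes "matroid M"
  shows "matroid_rank M X \<le> card X"
proof -
  obtain I where "I \<subseteq> X" "card I = matroid_rank M X"
    by (rule matroid_rank_attained[OF assms, of X])
  then show ?thesis using card_mono[of X I] by simp
qed

lemma subcodes_Supp_subset: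
  "{D \<in> subcodes r C. Supp D \<subseteq> Y} = subcodes r (shortened C (- Y))"
  by (auto simp: subcodes_def shortened_def Supp_def vsupp_def)

section \<open>Rational functions\<close>

lemma rf_const_0 [simp]: "rf_const 0 = 0"
  by (simp add: rf_const_def Zero_fract_def)

lemma rf_const_1 [simp]: "rf_const 1 = 1"
  by (simp add: rf_const_def One_fract_def flip: one_pCons)

lemma rf_const_add: "rf_const (a + b) = rf_const a + rf_const b"
  by (simp add: rf_const_def)

lemma rf_const_mult: "rf_const (a * b) = rf_const a * rf_const b"
  by (simp add: rf_const_def)

lemma rf_const_diff: "rf_const (a - b) = rf_const a - rf_const b"
  by (simp add: rf_const_def)

lemma rf_const_power: "rf_const (a ^ m) = rf_const a ^ m"
  by (induction m) (simp_all add: rf_const_mult)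

lemma rf_const_sum: "rf_const (sum g S) = (\<Sum>s\<in>S. rf_const (g s))"
  by (induction S rule: infinite_finite_induct) (simp_all add: rf_const_add)

lemma rf_const_of_nat: "rf_const (of_nat m) = of_nat m"
  by (induction m) (simp_all add: rf_const_add)

lemma rf_x_nonzero: "rf_x \<noteq> 0" and rf_y_nonzero: "rf_y \<noteq> 0" and rf_x_neq_y: "rf_x \<noteq> rf_y"
  by (simp_all add: rf_x_def rf_y_def Zero_fract_def eq_fract)

section \<open>Sums over supersets\<close>

lemma sum_supersets_power:
  fixes x y :: "'b::comm_ring_1" and S :: "'n::finite set"
  shows "(\<Sum>Y | S \<subseteq> Y. y ^ card Y * (x - y) ^ card (- Y)) = y ^ card S * x ^ card (- S)"
proof -
  have "(\<Sum>Y | S \<subseteq> Y. y ^ card Y * (x - y) ^ card (- Y))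
      = (\<Sum>T\<in>Pow (- S). y ^ card S * (y ^ card T * (x - y) ^ (card (- S) - card T)))"
  proof (rule sum.reindex_bij_witness[of _ "\<lambda>T. S \<union> T" "\<lambda>Y. Y - S"])
    fix Y assume "Y \<in> {Y. S \<subseteq> Y}"
    then have "card Y = card S + card (Y - S)" "card (- S) - card (Y - S) = card (- Y)"
      by (auto simp: card_Diff_subset card_mono Compl_eq_Diff_UNIV)
    then show "y ^ card S * (y ^ card (Y - S) * (x - y) ^ (card (- S) - card (Y - S)))
        = y ^ card Y * (x - y) ^ card (- Y)"
      by (simp add: power_add mult.assoc)
  qed auto
  also have "\<dots> = y ^ card S * (y + (x - y)) ^ card (- S)"
    by (subst sum_power_subsets[symmetric]) (simp_all add: sum_distrib_left)
  finally show ?thesis by simp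
qed

text \<open>
  After multiplication by \<open>y^d (x - y)^d\<close>, expand \<open>f~(Y)\<close> into its \<open>d\<close>-subsets \<open>Z\<close>.  The sum over
  \<open>Y \<supseteq> S \<union> Z\<close> is \<open>y^|S \<union> Z| x^(n - |S \<union> Z|)\<close>, which depends on \<open>Z\<close> through \<open>(y / x)^|Z - S|\<close> only,
  so that the generating function with \<open>a = 1\<close> and \<open>b = y / x\<close> applies.
\<close>

lemma harm_tilde_sum_supersets:
  fixes f :: "'n::finite set \<Rightarrow> real" and x y :: ratfun
  assumes f: "harmonic d f" and x: "x \<noteq> 0" and y: "y \<noteq> 0" and xy: "x \<noteq> y"
  shows "(\<Sum>Y | S \<subseteq> Y. rf_const (harm_tilde d f Y) * y ^ (card Y - d) * (x - y) ^ (CARD('n) - card Y - d))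
       = rf_const (harm_tilde d f S) * y ^ (card S - d) * x ^ (CARD('n) - card S - d)"
    (is "(\<Sum>Y | S \<subseteq> Y. ?G Y) = ?R")
proof -
  let ?h = "\<lambda>Y. rf_const (harm_tilde d f Y)"
  \<comment> \<open>The exponents may be lowered by \<open>d\<close> without truncation, as \<open>f~\<close> vanishes wherever this would fail.\<close>
  have shift: "?h Y * (y ^ card Y * w ^ card (- Y))
      = ?h Y * y ^ (card Y - d) * w ^ (CARD('n) - card Y - d) * (y ^ d * w ^ d)" for Y w
  proof (cases "card Y < d \<or> CARD('n) < card Y + d")
    case True
    then show ?thesis using harm_tilde_eq_0[OF f] by simp
  next
    case False
    then have "card Y = (card Y - d) + d" "card (- Y) = (CARD('n) - card Y - d) + d"
      by (simp_all add: card_compl)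
    then have "y ^ card Y * w ^ card (- Y)
        = y ^ (card Y - d) * w ^ (CARD('n) - card Y - d) * (y ^ d * w ^ d)"
      by (metis (no_types, opaque_lifting) mult.assoc mult.left_commute power_add)
    then show ?thesis by (simp add: mult.assoc)
  qed
  have tilde: "?h Y = (\<Sum>Z | Z \<in> {Z. card Z = d} \<and> Z \<subseteq> Y. rf_const (f Z))" for Y
    by (simp add: harm_tilde_def rf_const_sum)
  have "(\<Sum>Y | S \<subseteq> Y. ?G Y) * (y ^ d * (x - y) ^ d)
      = (\<Sum>Y | S \<subseteq> Y. ?h Y * (y ^ card Y * (x - y) ^ card (- Y)))"
    unfolding sum_distrib_right by (intro sum.cong refl) (simp only: shift)
  also have "\<dots> = (\<Sum>Y\<in>{Y. S \<subseteq> Y}. \<Sum>Z | Z \<in> {Z. card Z = d} \<and> Z \<subseteq> Y.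
      rf_const (f Z) * (y ^ card Y * (x - y) ^ card (- Y)))"
    by (simp add: tilde sum_distrib_right)
  also have "\<dots> = (\<Sum>Z | card Z = d. \<Sum>Y | Y \<in> {Y. S \<subseteq> Y} \<and> Z \<subseteq> Y.
      rf_const (f Z) * (y ^ card Y * (x - y) ^ card (- Y)))"
    by (rule sum.swap_restrict) simp_all
  also have "\<dots> = (\<Sum>Z | card Z = d. rf_const (f Z) * (\<Sum>Y | S \<union> Z \<subseteq> Y. y ^ card Y * (x - y) ^ card (- Y)))"
    unfolding sum_distrib_left by (intro sum.cong) auto
  also have "\<dots> = (\<Sum>Z | card Z = d. (y ^ card S * x ^ card (- S)) *
      (rf_const (f Z) * 1 ^ card (Z \<inter> S) * (y / x) ^ card (Z - S)))"
  proof (intro sum.cong refl)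
    fix Z
    have "card (S \<union> Z) = card S + card (Z - S)"
      using card_Un_disjoint[of S "Z - S"] by simp
    moreover have "- S = - (S \<union> Z) \<union> (Z - S)" by auto
    then have "card (- S) = card (- (S \<union> Z)) + card (Z - S)"
      using card_Un_disjoint[of "- (S \<union> Z)" "Z - S"] by auto
    ultimately show "rf_const (f Z) * (\<Sum>Y | S \<union> Z \<subseteq> Y. y ^ card Y * (x - y) ^ card (- Y))
        = (y ^ card S * x ^ card (- S)) * (rf_const (f Z) * 1 ^ card (Z \<inter> S) * (y / x) ^ card (Z - S))"
      unfolding sum_supersets_power using x by (simp add: power_add power_divide)
  qed
  also have "\<dots> = (y ^ card S * x ^ card (- S)) * ((1 - y / x) ^ d * ?h S)"
    unfolding sum_distrib_left[symmetric]
    by (subst harmonic_generating_function)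
      (simp_all add: tilde harmonic_sum_supersets[OF f] flip: rf_const_sum)
  also have "\<dots> = ?h S * (y ^ card S * x ^ card (- S)) * ((x - y) / x) ^ d"
    using x by (simp add: diff_divide_distrib)
  also have "\<dots> = ?R * (y ^ d * (x - y) ^ d)"
    unfolding shift using x by (simp add: power_divide)
  finally show ?thesis using y xy by simp
qed

section \<open>From the weight enumerator to the Tutte polynomial\<close>

text \<open>
  The restriction to weights between \<open>d\<close> and \<open>n - d\<close> loses nothing, because \<open>f~\<close> is zero on all other
  supports.
\<close>

lemma harm_Z_eq_sum_subcodes:
  fixes C :: "('a::{field,finite} ^ 'n::finite) set"
  assumes f: "harmonic d f"
  shows "harm_Z C d f r x y = (\<Sum>D\<in>subcodes r C.
    rf_const (harm_tilde d f (Supp D)) * y ^ (wt D - d) * x ^ (CARD('n) - wt D - d))"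
    (is "_ = (\<Sum>D\<in>_. ?h D)")
proof -
  have "harm_Z C d f r x y = (\<Sum>i = d..CARD('n) - d. \<Sum>D | D \<in> subcodes r C \<and> wt D = i. ?h D)"
    unfolding harm_Z_def harm_weight_def rf_const_sum sum_distrib_right
    by (intro sum.cong refl) (auto simp: mult_ac)
  also have "\<dots> = (\<Sum>D\<in>subcodes r C. \<Sum>i | i \<in> {d..CARD('n) - d} \<and> wt D = i. ?h D)"
    by (rule sum.swap_restrict) simp_all
  also have "\<dots> = (\<Sum>D\<in>subcodes r C. ?h D)"
  proof (intro sum.cong refl)
    fix D :: "('a ^ 'n) set"
    show "(\<Sum>i | i \<in> {d..CARD('n) - d} \<and> wt D = i. ?h D) = ?h D"
    proof (cases "wt D \<in> {d..CARD('n) - d}")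
      case True
      then have "{i. i \<in> {d..CARD('n) - d} \<and> wt D = i} = {wt D}" by auto
      then show ?thesis by simp
    next
      case False
      then have "harm_tilde d f (Supp D) = 0"
        by (intro harm_tilde_eq_0[OF f]) (auto simp: wt_def)
      then show ?thesis by simp
    qed
  qed
  finally show ?thesis .
qed

text \<open>
  Each summand of the sum over subcodes \<open>D\<close> is itself a sum over the supersets of \<open>Supp D\<close>; after
  exchanging the sums, the subcodes with \<open>Supp D \<subseteq> Y\<close> are those of the words vanishing off \<open>Y\<close>.
\<close>

lemma harm_Z_eq_sum_sets:
  fixes C :: "('a::{field,finite} ^ 'n::finite) set"
  assumes f: "harmonic d f" and xy: "x \<noteq> 0" "y \<noteq> 0" "x \<noteq> y" and C: "vec.subspace C"
  shows "harm_Z C d f r x y = (\<Sum>Y\<in>UNIV.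
    rf_const (gauss_binomial CARD('a) (vec.dim (shortened C (- Y))) r) *
    (rf_const (harm_tilde d f Y) * y ^ (card Y - d) * (x - y) ^ (CARD('n) - card Y - d)))"
    (is "_ = (\<Sum>Y\<in>UNIV. ?B Y * ?F Y)")
proof -
  have "harm_Z C d f r x y = (\<Sum>D\<in>subcodes r C. \<Sum>Y | Y \<in> UNIV \<and> Supp D \<subseteq> Y. ?F Y)"
    unfolding harm_Z_eq_sum_subcodes[OF f] wt_def
    by (simp only: UNIV_I simp_thms harm_tilde_sum_supersets[OF f xy])
  also have "\<dots> = (\<Sum>Y\<in>UNIV. \<Sum>D | D \<in> subcodes r C \<and> Supp D \<subseteq> Y. ?F Y)"
    by (rule sum.swap_restrict) simp_all
  also have "\<dots> = (\<Sum>Y\<in>UNIV. ?B Y * ?F Y)"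
    unfolding subcodes_Supp_subset
    by (simp add: card_subcodes[OF subspace_shortened[OF C], symmetric] rf_const_of_nat)
  finally show ?thesis .
qed

text \<open>
  The summand of the Tutte polynomial at a set of size \<open>m\<close> and rank \<open>\<rho>\<close>, with \<open>u\<close> and \<open>v\<close> standing for
  \<open>x - y\<close> and \<open>y\<close>: \<open>k\<close> and \<open>\<rho>\<close> cancel from the exponents of \<open>u\<close> and \<open>v\<close>.
\<close>

lemma tutte_exponents:
  fixes u v c :: "'b::field"
  assumes "u \<noteq> 0" "v \<noteq> 0" and "\<rho> \<le> k" "\<rho> \<le> m" "d \<le> m" "m + d \<le> n"
  shows "u powi (int k - int d) * v powi (int n - int k - int d) *
      ((c * v / u) ^ (k - \<rho>) * (u / v) ^ (m - \<rho>))
    = c ^ (k - \<rho>) * v ^ (n - m - d) * u ^ (m - d)"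
proof -
  have "u powi (int k - int d) * u powi - int (k - \<rho>) * u powi int (m - \<rho>)
      = u powi ((int k - int d) + - int (k - \<rho>) + int (m - \<rho>))"
    using assms(1) by (simp only: power_int_add simp_thms)
  also have "(int k - int d) + - int (k - \<rho>) + int (m - \<rho>) = int (m - d)"
    using assms by (simp add: of_nat_diff)
  finally have u: "u powi (int k - int d) * inverse (u ^ (k - \<rho>)) * u ^ (m - \<rho>) = u ^ (m - d)"
    by (simp only: power_int_minus power_int_of_nat)
  have "v powi (int n - int k - int d) * v powi int (k - \<rho>) * v powi - int (m - \<rho>)
      = v powi ((int n - int k - int d) + int (k - \<rho>) + - int (m - \<rho>))"
    using assms(2) by (simp only: power_int_add simp_thms)
  also have "(int n - int k - int d) + int (k - \<rho>) + - int (m - \<rho>) = int (n - m - d)"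
    using assms by (simp add: of_nat_diff)
  finally have v: "v powi (int n - int k - int d) * v ^ (k - \<rho>) * inverse (v ^ (m - \<rho>)) = v ^ (n - m - d)"
    by (simp only: power_int_minus power_int_of_nat)
  show ?thesis
    unfolding u[symmetric] v[symmetric] divide_inverse power_mult_distrib power_inverse
    by (simp only: mult_ac)
qed

text \<open>
  Here \<open>c\<close> plays the part of \<open>q^j\<close>: subtracting 1 from the two arguments of the Tutte
  polynomial leaves \<open>c y / (x - y)\<close> and \<open>(x - y) / y\<close>, which are nearly reciprocal.  The sum is reindexed by complements to compare it with the code side.
\<close>

lemma harm_tutte_code_matroid:
  fixes C :: "('a::{field,finite} ^ 'n::finite) set" and x y :: ratfun
  assumes C: "vec.subspace C" and f: "harmonic d f"
    and y: "y \<noteq> 0" and xy: "x \<noteq> y"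
  shows "(x - y) powi (int (vec.dim C) - int d) * y powi (int CARD('n) - int (vec.dim C) - int d) *
      harm_tutte (code_matroid C) d f ((x + rf_const (c - 1) * y) / (x - y)) (x / y)
    = (\<Sum>Y\<in>UNIV. rf_const ((- 1) ^ d * c ^ vec.dim (shortened C (- Y))) *
        (rf_const (harm_tilde d f Y) * y ^ (card Y - d) * (x - y) ^ (CARD('n) - card Y - d)))"
proof -
  let ?M = "code_matroid C" and ?k = "vec.dim C" and ?n = "CARD('n)"
  let ?u = "x - y"
  have u: "?u \<noteq> 0" using xy by simp
  have X1: "(x + rf_const (c - 1) * y) / ?u - 1 = rf_const c * y / ?u"
    using u by (simp add: rf_const_diff field_simps)
  have Y1: "x / y - 1 = ?u / y" using y by (simp add: field_simps)
  have dim: "?k - matroid_rank ?M X = vec.dim (shortened C X)" for X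
    using dim_shortened[OF C, of X] by simp
  let ?p = "?u powi (int ?k - int d) * y powi (int ?n - int ?k - int d)"
  have "?p * harm_tutte ?M d f ((x + rf_const (c - 1) * y) / ?u) (x / y)
      = (\<Sum>X\<in>UNIV. rf_const (harm_tilde d f X) * (?p *
          ((rf_const c * y / ?u) ^ (?k - matroid_rank ?M X) * (?u / y) ^ (card X - matroid_rank ?M X))))"
    unfolding harm_tutte_def X1 Y1 matroid_rank_UNIV_code[OF C] sum_distrib_left
    by (intro sum.cong refl) (simp only: mult_ac)
  also have "\<dots> = (\<Sum>X\<in>UNIV. rf_const (harm_tilde d f X) *
      (rf_const c ^ vec.dim (shortened C X) * y ^ (?n - card X - d) * ?u ^ (card X - d)))"
  proof (intro sum.cong refl)
    fix X :: "'n set"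
    show "rf_const (harm_tilde d f X) * (?p *
          ((rf_const c * y / ?u) ^ (?k - matroid_rank ?M X) * (?u / y) ^ (card X - matroid_rank ?M X)))
      = rf_const (harm_tilde d f X) *
          (rf_const c ^ vec.dim (shortened C X) * y ^ (?n - card X - d) * ?u ^ (card X - d))"
    proof (cases "card X < d \<or> ?n < card X + d")
      case True
      then show ?thesis using harm_tilde_eq_0[OF f] by simp
    next
      case False
      have "matroid_rank ?M X \<le> ?k" using dim_shortened[OF C, of X] by simp
      then show ?thesis
        using False u y matroid_rank_le_card[OF matroid_code_matroid, of C X]
        by (subst tutte_exponents) (simp_all add: dim)
    qed
  qed
  also have "\<dots> = (\<Sum>Y\<in>UNIV. rf_const ((- 1) ^ d * c ^ vec.dim (shortened C (- Y))) *
      (rf_const (harm_tilde d f Y) * y ^ (card Y - d) * ?u ^ (?n - card Y - d)))"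
  proof (rule sum.reindex_bij_witness[of _ uminus uminus])
    fix X :: "'n set"
    have card_X: "?n - (?n - card X) = card X" by (simp add: card_mono)
    have sign: "rf_const (- 1) ^ d * (rf_const (- 1) ^ d * t) = t" for t
      by (simp flip: rf_const_mult power_mult_distrib mult.assoc)
    show "rf_const ((- 1) ^ d * c ^ vec.dim (shortened C (- (- X)))) *
        (rf_const (harm_tilde d f (- X)) * y ^ (card (- X) - d) * ?u ^ (?n - card (- X) - d))
      = rf_const (harm_tilde d f X) *
        (rf_const c ^ vec.dim (shortened C X) * y ^ (?n - card X - d) * ?u ^ (card X - d))"
      unfolding harm_tilde_Compl[OF f] card_compl double_compl
      by (simp only: card_X rf_const_mult rf_const_power mult_ac sign)
  qed auto
  finally show ?thesis .
qed

theorem theorem4p2: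
  fixes C :: "('a::{field,finite} ^ 'n::finite) set"
    and f :: "'n set \<Rightarrow> real"
    and q n k d r :: nat
  assumes "q = CARD('a)"
    and "n = CARD('n)"
    and "vec.subspace C"
    and "vec.dim C = k"
    and "1 \<le> d" and "d \<le> n"
    and "harmonic d f"
    and "r \<le> k"
  shows "harm_Z C d f r rf_x rf_y =
    rf_const (1 / q_bracket q r r) *
    (\<Sum>j = 0..r.
      rf_const (gauss_binomial q r j * (-1) ^ (r + d - j) * real q ^ ((r - j) choose 2)) *
      (rf_x - rf_y) powi (int k - int d) * rf_y powi (int n - int k - int d) *
      harm_tutte (code_matroid C) d f
        ((rf_x + rf_const (real q ^ j - 1) * rf_y) / (rf_x - rf_y))
        (rf_x / rf_y))"
proof -
  note C = \<open>vec.subspace C\<close> and f = \<open>harmonic d f\<close>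
  note xy = rf_x_nonzero rf_y_nonzero rf_x_neq_y
  have q: "1 < q" using one_less_card_field \<open>q = CARD('a)\<close> by blast
  define F where "F Y = rf_const (harm_tilde d f Y) * rf_y ^ (card Y - d) *
    (rf_x - rf_y) ^ (n - card Y - d)" for Y
  define m where "m Y = vec.dim (shortened C (- Y))" for Y
  define b where "b j = gauss_binomial q r j * (-1) ^ (r + d - j) * real q ^ ((r - j) choose 2)" for j
  \<comment> \<open>The signs \<open>(-1)^d\<close> from the prefactor and from complementation cancel.\<close>
  have coeff: "1 / q_bracket q r r * (\<Sum>j = 0..r. b j * ((- 1) ^ d * (real q ^ j) ^ a))
      = gauss_binomial q a r" for a
  proof -
    have "b j * ((- 1) ^ d * (real q ^ j) ^ a)
        = gauss_binomial q r j * (-1) ^ (r - j) * real q ^ ((r - j) choose 2) * (real q ^ a) ^ j"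
      if "j \<le> r" for j
    proof -
      have "r + d - j = (r - j) + d" using that by simp
      then show ?thesis
        by (simp add: b_def power_add mult.commute flip: power_mult power_mult_distrib)
    qed
    then have "(\<Sum>j = 0..r. b j * ((- 1) ^ d * (real q ^ j) ^ a)) = (\<Prod>i<r. real q ^ a - real q ^ i)"
      by (simp add: atLeast0AtMost flip: gauss_binomial_theorem[OF q])
    then show ?thesis by (simp add: gauss_binomial_def q_bracket_def)
  qed
  have "rf_const (1 / q_bracket q r r) *
    (\<Sum>j = 0..r. rf_const (b j) *
      (rf_x - rf_y) powi (int k - int d) * rf_y powi (int n - int k - int d) *
      harm_tutte (code_matroid C) d f
        ((rf_x + rf_const (real q ^ j - 1) * rf_y) / (rf_x - rf_y)) (rf_x / rf_y))
    = rf_const (1 / q_bracket q r r) *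
      (\<Sum>j = 0..r. rf_const (b j) * (\<Sum>Y\<in>UNIV. rf_const ((- 1) ^ d * (real q ^ j) ^ m Y) * F Y))"
    using harm_tutte_code_matroid[OF C f xy(2,3)] assms(2,4)
    by (simp add: mult.assoc F_def m_def)
  also have "\<dots> = (\<Sum>Y\<in>UNIV. rf_const (1 / q_bracket q r r *
      (\<Sum>j = 0..r. b j * ((- 1) ^ d * (real q ^ j) ^ m Y))) * F Y)"
    unfolding rf_const_mult rf_const_sum sum_distrib_left sum_distrib_right
    by (subst sum.swap) (simp only: mult.assoc)
  also have "\<dots> = harm_Z C d f r rf_x rf_y"
    unfolding coeff harm_Z_eq_sum_sets[OF f xy C] F_def m_def
    using assms(1,2) by simp
  finally show ?thesis by (simp add: b_def)
qed

end
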